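(* Let $\kappa$ be a cardinal and let $J$ be a normal, uniform, $\gamma$-saturated ideal on $\kappa$ for some $\gamma<\kappa$. Then for every ordinal $\nu\in[\gamma,\kappa)$ and every $n\in\omega$, the $|\nu|$-$J^{n+1}$-weak-$\Delta$-system lemma holds; that is: for every $X\in (J^{n+1})^+$ and every family $\langle X_a\in[\kappa]^{<|\nu|}: a\in X\rangle$, there exist a function $W:[\kappa]^{\leq n}\to[\kappa]^{<|\nu|}$ and a set $Y\subseteq X$ with $Y\in (J^{n+1})^+$ such that for all distinct $a,b\in Y$ with $a\simeq b$, we have $X_a\cap X_b\subseteq W(a\cap b)$.
   Context: All ideals are proper ($\kappa\notin J$) and uniform ($[\kappa]^{<\kappa}\subseteq J$). $J^*=\{A\subseteq\kappa:\kappa\setminus A\in J\}$ is the dual filter and $J^+=\mathcal P(\kappa)\setminus J$ the positive sets. Normality is in the usual sense (closure under diagonal unions). $J$ is $\gamma$-saturated if for every $\langle X_i: i<\gamma\rangle\subseteq J^+$ there are $i<j<\gamma$ with $X_i\cap X_j\in J^+$. For $n\ge 1$, $[\kappa]^n$ denotes the set of strictly increasing $n$-tuples of ordinals below $\kappa$, identified with $n$-element subsets of $\kappa$; $[\kappa]^{\le n}$ is the set of subsets of $\kappa$ of size at most $n$. Fubini powers: $J^0=\{\emptyset\}$ on $[\kappa]^0=\{\emptyset\}$, $J^1=J$, and for $n\ge 2$ a set $X\subseteq[\kappa]^n$ belongs to $J^n$ iff $\{\alpha<\kappa:\{\bar\beta\in[\kappa]^{n-1}:(\alpha,\bar\beta)\in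 X\}\in J^{n-1}\}\in J^*$; $(J^n)^+$ denotes the subsets of $[\kappa]^n$ not in $J^n$. For $a,b\in[\kappa]^n$, $a\simeq b$ means that the unique order-preserving bijection from $a$ onto $b$ is the identity on $a\cap b$.
   Formalization: The ordinal ν is additionally required to be infinite; for finite ν the claim fails, e.g. for J dual to a normal measure, γ=ν=2, n=2 and X_{α<β<δ}={β}, where W({x,y}) would have to contain both x and y. *)

theory Defs
  imports "HOL-Library.Ramsey" "HOL-Library.FuncSet"
begin

unbundle cardinal_syntax

text \<open>
  The cardinal \<open>\<kappa>\<close> is represented by a well-ordered type \<open>'k\<close>: the elements of \<open>'k\<close> are the
  ordinals below \<open>\<kappa>\<close>, the set \<open>\<kappa>\<close> itself is \<open>UNIV\<close>, and an ordinal \<open>\<nu> < \<kappa>\<close>, regarded as the set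
  of its predecessors, is \<open>{..<\<nu>}\<close>. The following says that the order type of \<open>'k\<close> is an
  initial ordinal.
\<close>

definition is_cardinal :: "'k::wellorder itself \<Rightarrow> bool" where
  "is_cardinal _ \<longleftrightarrow> card_order {(\<alpha>, \<beta> :: 'k). \<alpha> \<le> \<beta>}"

text \<open>\<open>[\<kappa>]\<^bsup><\<lambda>\<^esup>\<close>, where the cardinal \<open>\<lambda>\<close> is given as a cardinal order relation. The set
  \<open>[\<kappa>]\<^sup>n\<close> is \<open>[UNIV]\<^bsup>n\<^esup>\<close> of \<^theory>\<open>HOL-Library.Ramsey\<close>.\<close>

definition subsets_less :: "'b rel \<Rightarrow> 'k set set" where
  "subsets_less lam = {A. |A| <o lam}"

definition subsets_at_most :: "nat \<Rightarrow> 'k set set" where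
  "subsets_at_most n = {A. finite A \<and> card A \<le> n}"

definition is_ideal :: "'k set set \<Rightarrow> bool" where
  "is_ideal J \<longleftrightarrow> {} \<in> J \<and> (\<forall>A\<in>J. \<forall>B. B \<subseteq> A \<longrightarrow> B \<in> J) \<and> (\<forall>A\<in>J. \<forall>B\<in>J. A \<union> B \<in> J)"

definition proper_ideal :: "'k set set \<Rightarrow> bool" where
  "proper_ideal J \<longleftrightarrow> UNIV \<notin> J"

definition uniform_ideal :: "'k set set \<Rightarrow> bool" where
  "uniform_ideal J \<longleftrightarrow> subsets_less |UNIV :: 'k set| \<subseteq> J"

definition dual_filter :: "'k set set \<Rightarrow> 'k set set" where
  "dual_filter J = {A. UNIV - A \<in> J}"

definition positive :: "'k set set \<Rightarrow> 'k set set" where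
  "positive J = Pow UNIV - J"

definition diagonal_union :: "('k::wellorder \<Rightarrow> 'k set) \<Rightarrow> 'k set" where
  "diagonal_union A = {\<beta>. \<exists>\<alpha><\<beta>. \<beta> \<in> A \<alpha>}"

definition normal_ideal :: "'k::wellorder set set \<Rightarrow> bool" where
  "normal_ideal J \<longleftrightarrow> (\<forall>A. (\<forall>\<alpha>. A \<alpha> \<in> J) \<longrightarrow> diagonal_union A \<in> J)"

text \<open>Only the values of the sequence at indices below \<open>\<gamma>\<close> matter.\<close>

definition saturated_ideal :: "'k::wellorder \<Rightarrow> 'k set set \<Rightarrow> bool" where
  "saturated_ideal \<gamma> J \<longleftrightarrow>
     (\<forall>X :: 'k \<Rightarrow> 'k set. (\<forall>i<\<gamma>. X i \<in> positive J) \<longrightarrow>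
        (\<exists>i j. i < j \<and> j < \<gamma> \<and> X i \<inter> X j \<in> positive J))"

text \<open>
  Strictly increasing \<open>n\<close>-tuples are identified with \<open>n\<close>-element sets. Under this identification
  the tuple \<open>(\<alpha>, b)\<close> with \<open>b \<in> [\<kappa>]\<^sup>n\<close> is \<open>insert \<alpha> b\<close>, subject to \<open>\<alpha>\<close> lying strictly below
  all elements of \<open>b\<close>, and a subset \<open>X\<close> of \<open>[\<kappa>]\<^sup>1\<close> is the subset \<open>{\<alpha>. {\<alpha>} \<in> X}\<close> of \<open>\<kappa>\<close>.
  In \<open>fubini_section n X \<alpha>\<close>, \<open>X\<close> is a set of \<open>(n+1)\<close>-element sets.
\<close>

definition fubini_section :: "nat \<Rightarrow> 'k::wellorder set set \<Rightarrow> 'k \<Rightarrow> 'k set set" where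
  "fubini_section n X \<alpha> = {b \<in> [UNIV]\<^bsup>n\<^esup>. (\<forall>\<beta>\<in>b. \<alpha> < \<beta>) \<and> insert \<alpha> b \<in> X}"

fun fubini_power :: "'k::wellorder set set \<Rightarrow> nat \<Rightarrow> 'k set set set" where
  "fubini_power J 0 = {{}}"
| "fubini_power J (Suc 0) = {X. X \<subseteq> [UNIV]\<^bsup>Suc 0\<^esup> \<and> {\<alpha>. {\<alpha>} \<in> X} \<in> J}"
| "fubini_power J (Suc (Suc n)) =
     {X. X \<subseteq> [UNIV]\<^bsup>Suc (Suc n)\<^esup> \<and>
         {\<alpha>. fubini_section (Suc n) X \<alpha> \<in> fubini_power J (Suc n)} \<in> dual_filter J}"

definition fubini_positive :: "'k::wellorder set set \<Rightarrow> nat \<Rightarrow> 'k set set set" where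
  "fubini_positive J n = Pow ([UNIV]\<^bsup>n\<^esup>) - fubini_power J n"

text \<open>\<open>a \<simeq> b\<close>. For finite \<open>a\<close>, \<open>b\<close> of the same size, the values of \<open>f\<close> on \<open>a\<close> are uniquely
  determined by the first two conjuncts.\<close>

definition aligned :: "'k::wellorder set \<Rightarrow> 'k set \<Rightarrow> bool" where
  "aligned a b \<longleftrightarrow> (\<exists>f. bij_betw f a b \<and> strict_mono_on a f \<and> (\<forall>x \<in> a \<inter> b. f x = x))"

text \<open>The \<open>\<lambda>\<close>-\<open>J\<close>-weak-\<open>\<Delta>\<close>-system lemma for the power \<open>n + 1\<close> of \<open>J\<close>. It is meaningful mainly for
  infinite \<open>\<lambda>\<close>: if \<open>J\<close> is the dual of a normal ultrafilter, it fails for \<open>\<lambda> = 2\<close>, \<open>n = 2\<close> and the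
  family assigning \<open>{\<beta>}\<close> to each triple \<open>\<alpha> < \<beta> < \<delta>\<close>, since \<open>W {x, y}\<close> would have to contain
  both \<open>x\<close> and \<open>y\<close>.\<close>

definition weak_Delta_system_lemma :: "'b rel \<Rightarrow> 'k::wellorder set set \<Rightarrow> nat \<Rightarrow> bool" where
  "weak_Delta_system_lemma lam J n \<longleftrightarrow>
     (\<forall>X \<in> fubini_positive J (n + 1). \<forall>F \<in> X \<rightarrow> (subsets_less lam :: 'k set set).
        \<exists>W \<in> subsets_at_most n \<rightarrow> subsets_less lam.
        \<exists>Y \<in> fubini_positive J (n + 1). Y \<subseteq> X \<and>
          (\<forall>a\<in>Y. \<forall>b\<in>Y. a \<noteq> b \<longrightarrow> aligned a b \<longrightarrow> F a \<inter> F b \<subseteq> W (a \<inter> b)))"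

end

theory Submission
  imports Defs
begin

text \<open>
  Write \<open>small\<close> for "of size less than \<open>|\<nu>|\<close>". By Fodor's lemma and saturation, if \<open>H \<alpha> \<subseteq> \<alpha>\<close> has
  size at most a fixed \<open>\<mu> < |\<nu>|\<close> for all \<open>\<alpha>\<close> in a positive set, then on a positive subset all
  \<open>H \<alpha>\<close> are contained in one small set. Induct on the exponent and split an \<open>(n+1)\<close>-set as
  \<open>a = r \<union> {\<alpha>}\<close> with \<open>\<alpha> = max a\<close>. The previous fact, applied to \<open>\<alpha>\<close> for fixed \<open>r\<close>, covers
  \<open>X\<^sub>a \<inter> \<alpha>\<close> and also the image of \<open>X\<^sub>a\<close> under an injection into \<open>\<alpha>\<close> by a small set \<open>G r\<close>, and the
  induction hypothesis applies to \<open>G\<close>. For \<open>a\<close>, \<open>b\<close> with the same maximum, the injections reduce the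
  intersection of \<open>X\<^sub>a\<close> and \<open>X\<^sub>b\<close> to that of \<open>G r\<close> and \<open>G q\<close>. If \<open>\<alpha> = max a < \<beta> = max b\<close>, then
  \<open>\<beta>\<close>, being a closure point of the construction, bounds \<open>X\<^sub>a\<close>. So \<open>X\<^sub>a \<inter> X\<^sub>b\<close> lies below \<open>\<beta>\<close>, in
  fact below \<open>\<alpha>\<close>, and hence again in \<open>G r \<inter> G q\<close>.
\<close>

section \<open>Cardinal arithmetic\<close>

lemma finite_ordLess_card_of:
  assumes "finite A" "infinite B"
  shows "|A| <o |B|"
  using assms by (intro finite_ordLess_infinite card_of_Well_order) (auto simp: Field_card_of)

lemma card_of_ordLeqE:
  assumes "|A| \<le>o |B|"
  obtains f where "inj_on f A" "f ` A \<subseteq> B"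
  using assms card_of_ordLeq[of A B] by blast

text \<open>Indexes the sizes below a cardinal by its own elements, so that a set of given size can
  be coded in an initial segment.\<close>

lemma ordLess_imp_ordLeq_underS:
  assumes "Card_order r" "|A| <o r"
  obtains i where "i \<in> Field r" "|A| \<le>o |underS r i|"
proof -
  from assms obtain i where i: "i \<in> Field r" "|A| =o Restr r (underS r i)"
    using ordLess_iff_ordIso_Restr[of r "|A|"] card_of_Well_order card_order_on_well_order_on
    by blast
  have "|Field |A| | \<le>o |Field (Restr r (underS r i))|"
    using card_of_mono2 ordIso_iff_ordLeq i(2) by blast
  moreover have "Field (Restr r (underS r i)) \<subseteq> underS r i"
    by (auto simp: Field_def)
  ultimately have "|A| \<le>o |underS r i|"
    using card_of_mono1 ordLeq_transitive by (metis Field_card_of)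
  with i(1) that show thesis by blast
qed

text \<open>The common bound \<open>M\<close> replaces regularity of \<open>|L|\<close>: the union
  has size at most that of \<open>K <+> M\<close>, unless both are finite.\<close>

lemma card_of_UNION_ordLess_bounded:
  assumes "infinite L" "|K| <o |L|" "|M| <o |L|" "\<And>k. k \<in> K \<Longrightarrow> |B k| \<le>o |M|"
  shows "|\<Union>k\<in>K. B k| <o |L|"
proof (cases "finite K \<and> finite M")
  case True
  then have "finite (\<Union>k\<in>K. B k)"
    using assms(4) card_of_ordLeq_finite by blast
  then show ?thesis
    using assms(1) by (simp add: finite_ordLess_card_of)
next
  case False
  let ?N = "K <+> M"
  have "infinite ?N" using False by auto
  moreover have "|K| \<le>o |?N|" "|M| \<le>o |?N|"
    by (rule card_of_Plus1, rule card_of_Plus2)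
  ultimately have "|\<Union>k\<in>K. B k| \<le>o |?N|"
    using assms(4) by (intro card_of_UNION_ordLeq_infinite) (auto intro: ordLeq_transitive)
  also have "|?N| <o |L|"
    using assms(1-3) by (rule card_of_Plus_ordLess_infinite)
  finally show ?thesis .
qed

lemma card_of_nsets_ordLeq:
  assumes "infinite A"
  shows "|[A]\<^bsup>n\<^esup>| \<le>o |A|"
proof (induction n)
  case 0
  then show ?case using assms by (simp add: finite_ordLess_card_of ordLess_imp_ordLeq)
next
  case (Suc n)
  have "[A]\<^bsup>Suc n\<^esup> \<subseteq> (\<lambda>(x, r). insert x r) ` (A \<times> [A]\<^bsup>n\<^esup>)"
  proof
    fix a assume "a \<in> [A]\<^bsup>Suc n\<^esup>"
    then obtain x r where "a = insert x r" "x \<notin> r" "a \<subseteq> A" "finite a" "card r = n"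
      by (auto simp: nsets_def card_Suc_eq)
    then show "a \<in> (\<lambda>(x, r). insert x r) ` (A \<times> [A]\<^bsup>n\<^esup>)"
      by (intro image_eqI[of _ _ "(x, r)"]) (auto simp: nsets_def)
  qed
  then have "|[A]\<^bsup>Suc n\<^esup>| \<le>o |A \<times> [A]\<^bsup>n\<^esup>|"
    using card_of_mono1 card_of_image ordLeq_transitive by blast
  also have "|A \<times> [A]\<^bsup>n\<^esup>| \<le>o |A|"
    using assms Suc.IH by (intro card_of_Times_ordLeq_infinite_Field)
      (auto simp: Field_card_of card_of_card_order_on card_of_refl ordIso_imp_ordLeq)
  finally show ?case .
qed

lemma card_of_Fpow_ordLeq:
  assumes "infinite A"
  shows "|Fpow A| \<le>o |A|"
proof -
  have "Fpow A = (\<Union>n\<in>(UNIV :: nat set). [A]\<^bsup>n\<^esup>)"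
    by (auto simp: Fpow_def nsets_def)
  moreover have "|\<Union>n\<in>(UNIV :: nat set). [A]\<^bsup>n\<^esup>| \<le>o |A|"
    using assms infinite_iff_card_of_nat card_of_nsets_ordLeq
    by (intro card_of_UNION_ordLeq_infinite) auto
  ultimately show ?thesis by simp
qed

text \<open>The order isomorphism must send the maximum \<alpha> to the maximum \<beta>, so it
  restricts to \<open>r\<close> and \<open>q\<close>. A maximum lying in the other set is fixed by
  it, which forces the two maxima to coincide.\<close>

lemma aligned_insert:
  assumes r: "\<forall>\<rho>\<in>r. \<rho> < \<alpha>" and q: "\<forall>\<rho>\<in>q. \<rho> < \<beta>"
    and "aligned (insert \<alpha> r) (insert \<beta> q)"
  shows "aligned r q" "\<alpha> \<in> insert \<beta> q \<Longrightarrow> \<alpha> = \<beta>" "\<beta> \<in> insert \<alpha> r \<Longrightarrow> \<alpha> = \<beta>"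
proof -
  obtain f where f: "bij_betw f (insert \<alpha> r) (insert \<beta> q)" "strict_mono_on (insert \<alpha> r) f"
    "\<And>x. x \<in> insert \<alpha> r \<inter> insert \<beta> q \<Longrightarrow> f x = x"
    using assms(3) unfolding aligned_def by blast
  have "\<beta> \<in> f ` insert \<alpha> r" using f(1) by (simp add: bij_betw_def)
  then obtain z where z: "z \<in> insert \<alpha> r" "f z = \<beta>" by blast
  have "f \<alpha> \<in> insert \<beta> q" using f(1) by (auto simp: bij_betw_def)
  then have "f \<alpha> \<le> \<beta>" using q by auto
  moreover have "f z < f \<alpha>" if "z \<in> r"
    using that r f(2) by (auto simp: strict_mono_on_def)
  ultimately have top: "f \<alpha> = \<beta>" using z by auto
  have "\<alpha> \<notin> r" "\<beta> \<notin> q" using r q by auto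
  then have "bij_betw f r q"
    using notIn_Un_bij_betw3[of \<alpha> r f q] f(1) top by simp
  moreover have "strict_mono_on r f"
    using f(2) by (auto simp: strict_mono_on_def)
  ultimately show "aligned r q"
    using f(3) unfolding aligned_def by blast
  show "\<alpha> = \<beta>" if "\<alpha> \<in> insert \<beta> q"
    using f(3)[of \<alpha>] that top by simp
  show "\<alpha> = \<beta>" if "\<beta> \<in> insert \<alpha> r"
  proof -
    have "f \<beta> = f \<alpha>" using f(3)[of \<beta>] that top by simp
    with inj_onD[OF bij_betw_imp_inj_on[OF f(1)]] that show ?thesis by fastforce
  qed
qed

section \<open>Normal ideals: regressive functions, completeness, regularity of the cardinal\<close>

locale saturated_normal_ideal =
  fixes J :: "'k::wellorder set set" and \<nu> :: 'k
  assumes cardinal: "is_cardinal TYPE('k)"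
    and ideal: "is_ideal J" and proper: "proper_ideal J"
    and uniform: "uniform_ideal J" and normal: "normal_ideal J"
    and saturated: "saturated_ideal \<nu> J"
    and infinite_index: "infinite {..<\<nu>}"
begin

abbreviation small :: "'b set \<Rightarrow> bool" where
  "small A \<equiv> |A| <o |{..<\<nu>}|"

lemma empty_null: "{} \<in> J"
  and null_mono: "A \<in> J \<Longrightarrow> B \<subseteq> A \<Longrightarrow> B \<in> J"
  and null_Un: "A \<in> J \<Longrightarrow> B \<in> J \<Longrightarrow> A \<union> B \<in> J"
  using ideal unfolding is_ideal_def by blast+

lemma UNIV_positive: "UNIV \<notin> J"
  using proper by (simp add: proper_ideal_def)

lemma positive_Diff: "A \<notin> J \<Longrightarrow> B \<in> J \<Longrightarrow> A - B \<notin> J"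
  using null_Un[of "A - B" B] null_mono[of "A - B \<union> B" A] by blast

lemma card_UNIV: "Card_order {(\<alpha>, \<beta> :: 'k). \<alpha> \<le> \<beta>}" "Field {(\<alpha>, \<beta> :: 'k). \<alpha> \<le> \<beta>} = UNIV"
  and card_UNIV_ordIso: "|UNIV :: 'k set| =o {(\<alpha>, \<beta> :: 'k). \<alpha> \<le> \<beta>}"
proof -
  let ?R = "{(\<alpha>, \<beta> :: 'k). \<alpha> \<le> \<beta>}"
  have "card_order ?R" using cardinal by (simp add: is_cardinal_def)
  then show "Card_order ?R" "Field ?R = UNIV" "|UNIV :: 'k set| =o ?R"
    using card_order_on_Card_order[of UNIV ?R] card_of_unique ordIso_symmetric by blast+
qed

lemma underS_UNIV: "underS {(\<alpha>, \<beta> :: 'k). \<alpha> \<le> \<beta>} \<delta> = {..<\<delta>}"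
  by (auto simp: underS_def)

lemma card_lessThan: "|{..<\<delta> :: 'k}| <o |UNIV :: 'k set|"
  using card_of_underS[OF card_UNIV(1), of \<delta>] card_UNIV(2) card_UNIV_ordIso
  by (metis UNIV_I ordIso_symmetric ordLess_ordIso_trans underS_UNIV)

lemma infinite_UNIV: "infinite (UNIV :: 'k set)"
  using infinite_index finite_subset subset_UNIV by blast

lemma lessThan_null: "{..<\<delta> :: 'k} \<in> J"
  using uniform card_lessThan by (auto simp: uniform_ideal_def subsets_less_def)

lemma atMost_null: "{..\<delta>} \<in> J"
proof -
  have "|{\<delta>}| <o |UNIV :: 'k set|"
    using infinite_UNIV by (simp add: finite_ordLess_card_of)
  then have "{\<delta>} \<in> J"
    using uniform by (auto simp: uniform_ideal_def subsets_less_def)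
  with lessThan_null[of \<delta>] have "{..<\<delta>} \<union> {\<delta>} \<in> J" by (rule null_Un)
  then show ?thesis by (simp only: ivl_disj_un_singleton)
qed

lemma diagonal_null: "(\<And>\<alpha>. A \<alpha> \<in> J) \<Longrightarrow> diagonal_union A \<in> J"
  using normal by (simp add: normal_ideal_def)

text \<open>Each \<alpha> in \<open>S\<close> lies in the fibre over
  \<open>f \<alpha> < \<alpha>\<close>, so \<open>S\<close> is contained in the diagonal union of
  the fibres; they cannot all be null.\<close>

lemma Fodor:
  assumes "S \<notin> J" "\<And>\<alpha>. \<alpha> \<in> S \<Longrightarrow> f \<alpha> < \<alpha>"
  obtains x where "{\<alpha>\<in>S. f \<alpha> = x} \<notin> J"
proof -
  have "S \<subseteq> diagonal_union (\<lambda>x. {\<alpha>\<in>S. f \<alpha> = x})"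
    using assms(2) by (auto simp: diagonal_union_def)
  then have "diagonal_union (\<lambda>x. {\<alpha>\<in>S. f \<alpha> = x}) \<notin> J"
    using assms(1) null_mono by blast
  then have "\<not> (\<forall>x. {\<alpha>\<in>S. f \<alpha> = x} \<in> J)"
    using diagonal_null[of "\<lambda>x. {\<alpha>\<in>S. f \<alpha> = x}"] by fast
  then obtain x where "{\<alpha>\<in>S. f \<alpha> = x} \<notin> J" by blast
  then show thesis by (rule that)
qed

text \<open>With the index set coded below some \<delta>, the union and the diagonal union agree
  above \<delta>, and the remaining segment \<open>{..\<delta>}\<close> is null.\<close>

lemma complete:
  assumes "|I| <o |UNIV :: 'k set|" "\<And>i. i \<in> I \<Longrightarrow> A i \<in> J"
  shows "(\<Union>i\<in>I. A i) \<in> J"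
proof -
  have "|I| <o {(\<alpha>, \<beta> :: 'k). \<alpha> \<le> \<beta>}"
    using assms(1) card_UNIV_ordIso ordLess_ordIso_trans by blast
  then obtain \<delta> :: 'k where "|I| \<le>o |{..<\<delta>}|"
    using ordLess_imp_ordLeq_underS[OF card_UNIV(1)] by (metis underS_UNIV)
  then obtain g where g: "inj_on g I" "g ` I \<subseteq> {..<\<delta>}"
    by (rule card_of_ordLeqE)
  define A' where "A' \<xi> = (if \<xi> \<in> g ` I then A (inv_into I g \<xi>) else {})" for \<xi>
  have "diagonal_union A' \<in> J"
    using assms(2) empty_null by (intro diagonal_null) (auto simp: A'_def inv_into_into)
  moreover have "(\<Union>i\<in>I. A i) \<subseteq> diagonal_union A' \<union> {..\<delta>}"
  proof
    fix \<beta> assume "\<beta> \<in> (\<Union>i\<in>I. A i)"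
    then obtain i where i: "i \<in> I" "\<beta> \<in> A i" by blast
    then have "\<beta> \<in> A' (g i)" using g by (simp add: A'_def)
    moreover have "g i < \<delta>" using i g by auto
    ultimately show "\<beta> \<in> diagonal_union A' \<union> {..\<delta>}"
      unfolding diagonal_union_def by (cases "\<beta> \<le> \<delta>") force+
  qed
  ultimately show ?thesis
    using null_Un[OF _ atMost_null] null_mono by blast
qed

lemma small_imp_less_UNIV: "small A \<Longrightarrow> |A| <o |UNIV :: 'k set|"
  using card_lessThan ordLess_transitive by blast

text \<open>This is regularity of the cardinal: by completeness, fewer than \<kappa> initial
  segments have a null union, which therefore omits some ordinal.\<close>

lemma bounded_of_card_less:
  assumes "|A| <o |UNIV :: 'k set|"
  obtains \<delta> :: 'k where "A \<subseteq> {..<\<delta>}"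
proof -
  have "(\<Union>x\<in>A. {..x}) \<in> J"
    using assms atMost_null by (rule complete)
  then have "(\<Union>x\<in>A. {..x}) \<noteq> UNIV" using UNIV_positive by metis
  then obtain \<delta> where "\<forall>x\<in>A. \<not> \<delta> \<le> x" by auto
  then show thesis using that[of \<delta>] by (auto simp: not_le)
qed

subsection \<open>Disjoint families of positive sets\<close>

text \<open>The index set \<open>A\<close> matters only through its size; keeping it as a set of any
  type avoids choosing cardinals as representatives.\<close>

definition packs :: "'k set \<Rightarrow> 'b set \<Rightarrow> bool" where
  "packs S A \<longleftrightarrow> (\<exists>P. (\<forall>x\<in>A. P x \<notin> J \<and> P x \<subseteq> S) \<and> (\<forall>x\<in>A. \<forall>y\<in>A. x \<noteq> y \<longrightarrow> P x \<inter> P y = {}))"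

lemma packs_ordLeq:
  assumes "packs S A" "|A'| \<le>o |A|"
  shows "packs S A'"
proof -
  obtain P where P: "\<forall>x\<in>A. P x \<notin> J \<and> P x \<subseteq> S"
    "\<forall>x\<in>A. \<forall>y\<in>A. x \<noteq> y \<longrightarrow> P x \<inter> P y = {}"
    using assms(1) unfolding packs_def by blast
  obtain f where f: "inj_on f A'" "f ` A' \<subseteq> A"
    using assms(2) by (rule card_of_ordLeqE)
  show ?thesis
    unfolding packs_def
  proof (intro exI[of _ "P \<circ> f"] conjI ballI impI)
    fix x y assume "x \<in> A'" "y \<in> A'" "x \<noteq> y"
    then have "f x \<noteq> f y" "f x \<in> A" "f y \<in> A" using f by (auto dest: inj_onD)
    then show "(P \<circ> f) x \<inter> (P \<circ> f) y = {}" using P(2) by simp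
  qed (use P(1) f(2) in auto)
qed

lemma packs_imp_small:
  assumes "packs S A"
  shows "small A"
proof (rule ccontr)
  assume "\<not> small A"
  then have "packs S {..<\<nu>}"
    using packs_ordLeq[OF assms] by (meson card_of_Well_order ordLess_or_ordLeq)
  then obtain P where P: "\<forall>x\<in>{..<\<nu>}. P x \<notin> J"
    "\<forall>x\<in>{..<\<nu>}. \<forall>y\<in>{..<\<nu>}. x \<noteq> y \<longrightarrow> P x \<inter> P y = {}"
    unfolding packs_def by blast
  have "\<forall>i<\<nu>. P i \<in> positive J"
    using P(1) by (simp add: positive_def)
  then obtain i j where ij: "i < j" "j < \<nu>" "P i \<inter> P j \<in> positive J"
    using saturated unfolding saturated_ideal_def by blast
  then have "P i \<inter> P j = {}"
    using P(2) by auto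
  then show False
    using ij(3) empty_null by (simp add: positive_def)
qed

text \<open>For singular \<open>|\<nu>|\<close> this is the argument by which Erdos and Tarski show that the least
  saturation number is regular: if the packing numbers were unbounded below \<open>|\<nu>|\<close> on every positive
  subset of \<open>T\<close>, then packings of subsets could be combined to a packing of size \<open>|\<nu>|\<close>.\<close>

lemma packs_Union:
  assumes "T \<notin> J" and "small K"
  obtains T' where "T' \<subseteq> T" "T' \<notin> J"
    "\<And>B :: 'i \<Rightarrow> 'b set. (\<And>k. k \<in> K \<Longrightarrow> packs T' (B k)) \<Longrightarrow> small (\<Union>k\<in>K. B k)"
proof (cases "regularCard |{..<\<nu>}|")
  case True
  have "small (\<Union>k\<in>K. B k)" if "\<And>k. k \<in> K \<Longrightarrow> packs T (B k)" for B :: "'i \<Rightarrow> 'b set"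
    using True assms(2) that packs_imp_small infinite_index
    by (intro card_of_UNION_ordLess_infinite_Field_regularCard)
      (auto simp: cinfinite_def Field_card_of card_of_card_order_on)
  then show ?thesis using that[of T] assms(1) by blast
next
  case False
  then obtain I where I: "I \<subseteq> {..<\<nu>}" "cofinal I |{..<\<nu>}|" "\<not> |I| =o |{..<\<nu>}|"
    unfolding regularCard_def by (auto simp: Field_card_of)
  then have smI: "small I"
    using card_of_mono1 ordLeq_iff_ordLess_or_ordIso by blast
  \<comment> \<open>Testing subsets of \<open>{..<\<nu>}\<close> is enough: every packed set is
    small, hence equinumerous with such a subset.\<close>
  define bd where "bd T' M \<longleftrightarrow> (\<forall>A\<subseteq>{..<\<nu>}. packs T' A \<longrightarrow> |A| \<le>o |M| )" for T' and M :: "'k set"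
  have "\<exists>T' M. T' \<subseteq> T \<and> T' \<notin> J \<and> M \<subseteq> {..<\<nu>} \<and> small M \<and> bd T' M"
  proof (rule ccontr)
    assume *: "\<not> ?thesis"
    have pk: "packs T' M" if "T' \<subseteq> T" "T' \<notin> J" "M \<subseteq> {..<\<nu>}" "small M" for T' M
    proof -
      have "\<not> bd T' M" using * that by blast
      then obtain A :: "'k set" where "packs T' A" "\<not> |A| \<le>o |M|" unfolding bd_def by blast
      from this(2) have "|M| \<le>o |A|"
        using ordLeq_total card_of_Well_order by blast
      with \<open>packs T' A\<close> show ?thesis by (rule packs_ordLeq)
    qed
    have "packs T I" by (rule pk[OF subset_refl assms(1) I(1) smI])
    then obtain P where P: "\<forall>x\<in>I. P x \<notin> J \<and> P x \<subseteq> T"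
      "\<forall>x\<in>I. \<forall>y\<in>I. x \<noteq> y \<longrightarrow> P x \<inter> P y = {}"
      unfolding packs_def by blast
    \<comment> \<open>Segments are taken in the minimal well-order \<open>|{..<\<nu>}|\<close>,
      where each is small; in the order of the ordinals a segment below \<nu> may already have size
      \<open>|\<nu>|\<close>.\<close>
    let ?U = "underS |{..<\<nu>}|"
    have "packs (P i) (?U i)" if "i \<in> I" for i
    proof -
      have "?U i \<subseteq> {..<\<nu>}"
        by (metis Field_card_of Order_Relation.underS_Field)
      moreover have "small (?U i)"
        using I(1) that by (intro card_of_underS card_of_Card_order) (auto simp: Field_card_of)
      moreover have "P i \<subseteq> T" "P i \<notin> J" using P(1) that by blast+
      ultimately show ?thesis using pk by blast
    qed
    then obtain Q where Q: "\<forall>i\<in>I. (\<forall>x\<in>?U i. Q i x \<notin> J \<and> Q i x \<subseteq> P i) \<and>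
        (\<forall>x\<in>?U i. \<forall>y\<in>?U i. x \<noteq> y \<longrightarrow> Q i x \<inter> Q i y = {})"
      unfolding packs_def by metis
    \<comment> \<open>Each \<open>P i\<close> is split further into pieces indexed by
      \<open>?U i\<close>. As \<open>I\<close> is cofinal, these segments cover
      \<open>{..<\<nu>}\<close>, so the pieces are too many for saturation.\<close>
    have "packs T (SIGMA i:I. ?U i)"
      unfolding packs_def
    proof (intro exI[of _ "\<lambda>(i, x). Q i x"] conjI ballI impI)
      fix p assume p: "p \<in> (SIGMA i:I. ?U i)"
      then show "(case p of (i, x) \<Rightarrow> Q i x) \<notin> J" using Q by auto
      from p show "(case p of (i, x) \<Rightarrow> Q i x) \<subseteq> T" using Q P(1) by fastforce
    next
      fix p q assume *: "p \<in> (SIGMA i:I. ?U i)" "q \<in> (SIGMA i:I. ?U i)" "p \<noteq> q"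
      obtain i x j y where pq: "p = (i, x)" "q = (j, y)" by (metis surj_pair)
      with * have ij: "i \<in> I" "x \<in> ?U i" "j \<in> I" "y \<in> ?U j" by auto
      show "(case p of (i, x) \<Rightarrow> Q i x) \<inter> (case q of (i, x) \<Rightarrow> Q i x) = {}"
      proof (cases "i = j")
        case True
        then show ?thesis using Q ij * pq by auto
      next
        case False
        then have "P i \<inter> P j = {}" using P(2) ij by blast
        moreover have "Q i x \<subseteq> P i" "Q j y \<subseteq> P j" using Q ij by auto
        ultimately show ?thesis using pq by auto
      qed
    qed
    moreover have "|{..<\<nu>}| \<le>o |SIGMA i:I. ?U i|"
    proof -
      have "{..<\<nu>} \<subseteq> (\<Union>i\<in>I. ?U i)"
        using I(2) by (auto simp: cofinal_def Field_card_of underS_def)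
      then show ?thesis
        using card_of_mono1 card_of_UNION_Sigma ordLeq_transitive by blast
    qed
    ultimately have "packs T {..<\<nu>}" by (rule packs_ordLeq)
    then show False using packs_imp_small ordLess_irreflexive by blast
  qed
  then obtain T' M where T': "T' \<subseteq> T" "T' \<notin> J" and M: "small M"
    and bd: "bd T' M" by blast
  have "small (\<Union>k\<in>K. B k)" if B: "\<And>k. k \<in> K \<Longrightarrow> packs T' (B k)" for B :: "'i \<Rightarrow> 'b set"
  proof (rule card_of_UNION_ordLess_bounded[OF infinite_index assms(2) M])
    fix k assume "k \<in> K"
    then have pk: "packs T' (B k)" by (rule B)
    then have "|B k| \<le>o |{..<\<nu>}|" using packs_imp_small ordLess_imp_ordLeq by blast
    then obtain f where "inj_on f (B k)" "f ` B k \<subseteq> {..<\<nu>}"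
      by (rule card_of_ordLeqE)
    then have *: "|B k| =o |f ` B k|"
      using card_of_ordIso inj_on_imp_bij_betw by blast
    then have "packs T' (f ` B k)"
      using pk packs_ordLeq ordIso_iff_ordLeq by blast
    then show "|B k| \<le>o |M|"
      using bd \<open>f ` B k \<subseteq> {..<\<nu>}\<close> * ordIso_ordLeq_trans unfolding bd_def by blast
  qed
  with T' that show ?thesis by blast
qed

text \<open>Code the elements of each \<open>H \<alpha>\<close> injectively in \<open>K\<close>. For
  a fixed code \<open>k\<close>, the sets of those \<alpha> at which \<open>x\<close> has code
  \<open>k\<close> are disjoint for different \<open>x\<close>, so few of them are positive;
  \<open>G\<close> collects these \<open>x\<close> over all codes. By completeness any other
  \<open>x\<close> belongs to \<open>H \<alpha>\<close> only for a null set of \<alpha>, and by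
  Fodor's lemma almost no \<alpha> has an element of \<open>H \<alpha>\<close> outside
  \<open>G\<close>.\<close>

lemma regressive_cover:
  assumes T: "T \<notin> J" and K: "small K"
    and H: "\<And>\<alpha>. \<alpha> \<in> T \<Longrightarrow> H \<alpha> \<subseteq> {..<\<alpha>}" "\<And>\<alpha>. \<alpha> \<in> T \<Longrightarrow> |H \<alpha>| \<le>o |K|"
  obtains T' G where "T' \<subseteq> T" "T' \<notin> J" "small G" "\<And>\<alpha>. \<alpha> \<in> T' \<Longrightarrow> H \<alpha> \<subseteq> G"
proof -
  obtain S where S: "S \<subseteq> T" "S \<notin> J"
    and un: "\<And>B :: _ \<Rightarrow> 'k set. (\<And>k. k \<in> K \<Longrightarrow> packs S (B k)) \<Longrightarrow> small (\<Union>k\<in>K. B k)"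
    using packs_Union[OF T K] by blast
  have "\<forall>\<alpha>\<in>T. \<exists>f. inj_on f (H \<alpha>) \<and> f ` H \<alpha> \<subseteq> K"
    using H(2) by (meson card_of_ordLeqE)
  then obtain f where f: "\<And>\<alpha>. \<alpha> \<in> T \<Longrightarrow> inj_on (f \<alpha>) (H \<alpha>) \<and> f \<alpha> ` H \<alpha> \<subseteq> K"
    by metis
  define P where "P k x = {\<alpha>\<in>S. x \<in> H \<alpha> \<and> f \<alpha> x = k}" for k x
  define G where "G = (\<Union>k\<in>K. {x. P k x \<notin> J})"
  have "packs S {x. P k x \<notin> J}" for k
    unfolding packs_def
    using f S(1) by (intro exI[of _ "P k"]) (auto simp: P_def inj_on_def)
  then have "small G" unfolding G_def by (rule un)
  have null: "{\<alpha>\<in>S. x \<in> H \<alpha>} \<in> J" if "x \<notin> G" for x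
  proof -
    have "(\<Union>k\<in>K. P k x) \<in> J"
      using small_imp_less_UNIV[OF K] by (rule complete) (use that in \<open>auto simp: G_def\<close>)
    moreover have "{\<alpha>\<in>S. x \<in> H \<alpha>} \<subseteq> (\<Union>k\<in>K. P k x)"
      using f S(1) by (auto simp: P_def)
    ultimately show ?thesis by (rule null_mono)
  qed
  define E where "E = {\<alpha>\<in>S. \<not> H \<alpha> \<subseteq> G}"
  have "E \<in> J"
  proof (rule ccontr)
    assume "E \<notin> J"
    have "\<forall>\<alpha>\<in>E. \<exists>x. x \<in> H \<alpha> \<and> x \<notin> G" by (auto simp: E_def)
    then obtain g where g: "\<And>\<alpha>. \<alpha> \<in> E \<Longrightarrow> g \<alpha> \<in> H \<alpha> \<and> g \<alpha> \<notin> G" by metis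
    then have "g \<alpha> < \<alpha>" if "\<alpha> \<in> E" for \<alpha>
      using that H(1) S(1) by (force simp: E_def)
    then obtain x where x: "{\<alpha>\<in>E. g \<alpha> = x} \<notin> J"
      using Fodor[OF \<open>E \<notin> J\<close>] by blast
    then have "x \<notin> G"
      using g empty_null by (metis (mono_tags, lifting) Collect_empty_eq)
    then have "{\<alpha>\<in>S. x \<in> H \<alpha>} \<in> J" by (rule null)
    moreover have "{\<alpha>\<in>E. g \<alpha> = x} \<subseteq> {\<alpha>\<in>S. x \<in> H \<alpha>}"
      using g by (auto simp: E_def)
    ultimately show False using x null_mono by blast
  qed
  have "S - E \<notin> J" using \<open>E \<in> J\<close> S(2) positive_Diff by blast
  show thesis
  proof (rule that)
    show "S - E \<subseteq> T" using S(1) by blast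
    show "H \<alpha> \<subseteq> G" if "\<alpha> \<in> S - E" for \<alpha>
      using that by (auto simp: E_def)
  qed fact+
qed

subsection \<open>Fubini powers\<close>

text \<open>Positivity for \<open>fubini_power\<close> by recursion on the last coordinate; \<open>stem n X\<close> consists of the
  \<open>n\<close>-sets with positively many end-extensions in \<open>X\<close>.\<close>

definition stem :: "nat \<Rightarrow> 'k set set \<Rightarrow> 'k set set" where
  "stem n X = {r \<in> [UNIV]\<^bsup>n\<^esup>. {\<alpha>. (\<forall>\<rho>\<in>r. \<rho> < \<alpha>) \<and> insert \<alpha> r \<in> X} \<notin> J}"

primrec pos :: "nat \<Rightarrow> 'k set set \<Rightarrow> bool" where
  "pos 0 X \<longleftrightarrow> {} \<in> X"
| "pos (Suc n) X \<longleftrightarrow> pos n (stem n X)"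

text \<open>Fixing the least coordinate commutes with quantifying over the greatest one.\<close>

lemma stem_fubini_section:
  "stem n (fubini_section (Suc n) X \<alpha>) = fubini_section n (stem (Suc n) X) \<alpha>"
proof (rule set_eqI)
  fix r
  show "r \<in> stem n (fubini_section (Suc n) X \<alpha>) \<longleftrightarrow> r \<in> fubini_section n (stem (Suc n) X) \<alpha>"
  proof (cases "r \<in> [UNIV]\<^bsup>n\<^esup> \<and> (\<forall>\<rho>\<in>r. \<alpha> < \<rho>)")
    case False
    then have "{\<beta>. (\<forall>\<rho>\<in>r. \<rho> < \<beta>) \<and> insert \<beta> r \<in> fubini_section (Suc n) X \<alpha>} = {}"
      if "r \<in> [UNIV]\<^bsup>n\<^esup>"
      using that by (auto simp: fubini_section_def)
    then have "r \<notin> stem n (fubini_section (Suc n) X \<alpha>)"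
      using empty_null unfolding stem_def mem_Collect_eq by metis
    moreover have "r \<notin> fubini_section n (stem (Suc n) X) \<alpha>"
      using False by (auto simp: fubini_section_def)
    ultimately show ?thesis by blast
  next
    case True
    have ins: "insert \<beta> r \<in> [UNIV]\<^bsup>Suc n\<^esup>" if "\<beta> \<notin> r" for \<beta>
      using that True by (auto simp: nsets_def)
    have "insert \<alpha> r \<in> [UNIV]\<^bsup>Suc n\<^esup>" using True ins by blast
    moreover have "{\<beta>. (\<forall>\<rho>\<in>r. \<rho> < \<beta>) \<and> insert \<beta> r \<in> fubini_section (Suc n) X \<alpha>} =
        {\<beta>. (\<forall>\<rho>\<in>insert \<alpha> r. \<rho> < \<beta>) \<and> insert \<beta> (insert \<alpha> r) \<in> X}"
      using True ins by (auto simp: fubini_section_def insert_commute)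
    ultimately show ?thesis
      using True by (simp add: stem_def fubini_section_def)
  qed
qed

text \<open>Turns the recursion on the last coordinate into the recursion on the first one that
  defines Fubini powers.\<close>

lemma pos_Suc_fubini_section: "pos (Suc n) X \<longleftrightarrow> {\<alpha>. pos n (fubini_section n X \<alpha>)} \<notin> J"
proof (induction n arbitrary: X)
  case 0
  have "{} \<in> [UNIV :: 'k set]\<^bsup>0\<^esup>" by (simp add: nsets_def)
  then show ?case by (simp add: stem_def fubini_section_def)
next
  case (Suc n)
  have "pos (Suc (Suc n)) X \<longleftrightarrow> pos (Suc n) (stem (Suc n) X)" by simp
  also have "\<dots> \<longleftrightarrow> {\<alpha>. pos n (fubini_section n (stem (Suc n) X) \<alpha>)} \<notin> J" by (rule Suc.IH)
  also have "\<dots> \<longleftrightarrow> {\<alpha>. pos (Suc n) (fubini_section (Suc n) X \<alpha>)} \<notin> J"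
    by (simp add: stem_fubini_section)
  finally show ?case .
qed

lemma fubini_section_subset: "fubini_section n X \<alpha> \<subseteq> [UNIV]\<^bsup>n\<^esup>"
  by (auto simp: fubini_section_def)

lemma pos_iff_notin_fubini_power:
  "X \<subseteq> [UNIV]\<^bsup>n\<^esup> \<Longrightarrow> pos n X \<longleftrightarrow> X \<notin> fubini_power J n"
proof (induction n arbitrary: X)
  case 0
  then have "X \<subseteq> {{}}" by (auto simp: nsets_def)
  then show ?case by auto
next
  case (Suc n)
  show ?case
  proof (cases n)
    case 0
    have "{} \<in> [UNIV :: 'k set]\<^bsup>0\<^esup>" by (simp add: nsets_def)
    with 0 Suc.prems show ?thesis by (simp add: stem_def)
  next
    case (Suc m)
    have "pos (Suc n) X \<longleftrightarrow> {\<alpha>. fubini_section n X \<alpha> \<notin> fubini_power J n} \<notin> J"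
      using Suc.IH[OF fubini_section_subset] by (simp only: pos_Suc_fubini_section)
    moreover have "UNIV - {\<alpha>. fubini_section n X \<alpha> \<in> fubini_power J n} =
        {\<alpha>. fubini_section n X \<alpha> \<notin> fubini_power J n}" by blast
    ultimately show ?thesis
      using Suc.prems Suc by (simp add: dual_filter_def)
  qed
qed

lemma fubini_positive_iff: "X \<in> fubini_positive J n \<longleftrightarrow> X \<subseteq> [UNIV]\<^bsup>n\<^esup> \<and> pos n X"
  using pos_iff_notin_fubini_power by (auto simp: fubini_positive_def)

lemma stem_mono:
  assumes "X \<subseteq> Y"
  shows "stem n X \<subseteq> stem n Y"
proof
  fix r assume r: "r \<in> stem n X"
  have "{\<alpha>. (\<forall>\<rho>\<in>r. \<rho> < \<alpha>) \<and> insert \<alpha> r \<in> X} \<subseteq> {\<alpha>. (\<forall>\<rho>\<in>r. \<rho> < \<alpha>) \<and> insert \<alpha> r \<in> Y}"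
    using assms by blast
  with r show "r \<in> stem n Y"
    unfolding stem_def using null_mono by blast
qed

lemma pos_mono: "X \<subseteq> Y \<Longrightarrow> pos n X \<Longrightarrow> pos n Y"
proof (induction n arbitrary: X Y)
  case (Suc n)
  from Suc.IH[OF stem_mono[OF Suc.prems(1)]] Suc.prems(2) show ?case by simp
qed auto

text \<open>Completeness passes to the powers: a positive set of end-extensions into the union has a
  positive part going into a single \<open>X i\<close>.\<close>

lemma pos_UN:
  assumes "|I| <o |UNIV :: 'k set|"
  shows "pos n (\<Union>i\<in>I. X i) \<Longrightarrow> \<exists>i\<in>I. pos n (X i)"
proof (induction n arbitrary: X)
  case 0
  then show ?case by simp
next
  case (Suc n)
  have "stem n (\<Union>i\<in>I. X i) \<subseteq> (\<Union>i\<in>I. stem n (X i))"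
  proof
    fix r assume r: "r \<in> stem n (\<Union>i\<in>I. X i)"
    define Z where "Z i = {\<alpha>. (\<forall>\<rho>\<in>r. \<rho> < \<alpha>) \<and> insert \<alpha> r \<in> X i}" for i
    have "{\<alpha>. (\<forall>\<rho>\<in>r. \<rho> < \<alpha>) \<and> insert \<alpha> r \<in> (\<Union>i\<in>I. X i)} = (\<Union>i\<in>I. Z i)"
      by (auto simp: Z_def)
    with r have "(\<Union>i\<in>I. Z i) \<notin> J" by (simp add: stem_def)
    then obtain i where "i \<in> I" "Z i \<notin> J"
      using complete[OF assms, of Z] by fast
    with r show "r \<in> (\<Union>i\<in>I. stem n (X i))"
      by (auto simp: stem_def Z_def)
  qed
  then show ?case
    using Suc.IH[of "\<lambda>i. stem n (X i)"] Suc.prems pos_mono by simp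
qed

text \<open>At each coordinate only a null set of extensions is lost, so positivity survives
  restriction to tuples from a set in the dual filter.\<close>

lemma pos_restrict:
  assumes "- C \<in> J"
  shows "pos n X \<Longrightarrow> pos n {a\<in>X. a \<subseteq> C}"
proof (induction n arbitrary: X)
  case 0
  then show ?case by simp
next
  case (Suc n)
  have "{r\<in>stem n X. r \<subseteq> C} \<subseteq> stem n {a\<in>X. a \<subseteq> C}"
  proof
    fix r assume r: "r \<in> {r\<in>stem n X. r \<subseteq> C}"
    let ?Z = "{\<alpha>. (\<forall>\<rho>\<in>r. \<rho> < \<alpha>) \<and> insert \<alpha> r \<in> X}"
    have "?Z - - C \<notin> J" using r assms by (intro positive_Diff) (auto simp: stem_def)
    moreover have "?Z - - C = {\<alpha>. (\<forall>\<rho>\<in>r. \<rho> < \<alpha>) \<and> insert \<alpha> r \<in> {a\<in>X. a \<subseteq> C}}"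
      using r by auto
    ultimately show "r \<in> stem n {a\<in>X. a \<subseteq> C}"
      using r by (simp add: stem_def)
  qed
  then show ?case
    using Suc.IH[of "stem n X"] Suc.prems pos_mono by simp
qed

section \<open>Closure points\<close>

lemma card_of_Fpow_atMost: "|Fpow {..\<beta> :: 'k}| <o |UNIV :: 'k set|"
proof (cases "finite {..\<beta>}")
  case True
  then have "finite (Fpow {..\<beta>})" by (simp add: Fpow_Pow_finite)
  then show ?thesis using infinite_UNIV by (rule finite_ordLess_card_of)
next
  case False
  have "{..\<beta>} \<noteq> UNIV"
    using atMost_null[of \<beta>] UNIV_positive by auto
  then obtain \<delta> where "\<not> \<delta> \<le> \<beta>" by auto
  then have "{..\<beta>} \<subseteq> {..<\<delta>}" by auto
  then have "|{..\<beta>}| <o |UNIV :: 'k set|"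
    using card_of_mono1 card_lessThan ordLeq_ordLess_trans by blast
  with card_of_Fpow_ordLeq[OF False] show ?thesis by (rule ordLeq_ordLess_trans)
qed

text \<open>By regularity a single ordinal \<open>h \<beta>\<close> bounds \<open>B s\<close> for
  all finite \<open>s\<close> below or at \<beta>. The ordinals not closed under \<open>h\<close>
  form a diagonal union of bounded sets, which is null.\<close>

lemma closure_points:
  fixes B :: "'k set \<Rightarrow> 'k set"
  assumes "\<And>s. finite s \<Longrightarrow> small (B s)"
  obtains C where "- C \<in> J"
    "\<forall>\<alpha>\<in>C. \<forall>s. finite s \<longrightarrow> s \<subseteq> {..<\<alpha>} \<longrightarrow> B s \<subseteq> {..<\<alpha>}"
proof -
  have "\<exists>\<delta>. B s \<subseteq> {..<\<delta>}" if "finite s" for s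
    using bounded_of_card_less[OF small_imp_less_UNIV[OF assms[OF that]]] by blast
  then obtain b where b: "\<And>s. finite s \<Longrightarrow> B s \<subseteq> {..<b s}" by metis
  have "\<exists>\<delta>. b ` Fpow {..\<beta>} \<subseteq> {..<\<delta>}" for \<beta>
  proof -
    have "|Fpow {..\<beta>}| <o |UNIV :: 'k set|" by (rule card_of_Fpow_atMost)
    then have "|b ` Fpow {..\<beta>}| <o |UNIV :: 'k set|"
      using card_of_image ordLeq_ordLess_trans by blast
    then show ?thesis using bounded_of_card_less by blast
  qed
  then obtain h where h: "\<And>\<beta>. b ` Fpow {..\<beta>} \<subseteq> {..<h \<beta>}" by metis
  \<comment> \<open>The condition \<open>\<nu> \<le> \<alpha>\<close> makes \<alpha> nonzero, which
    the case of empty \<open>s\<close> needs.\<close>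
  define C where "C = {\<alpha>. \<nu> \<le> \<alpha> \<and> (\<forall>\<beta><\<alpha>. h \<beta> \<le> \<alpha>)}"
  have "- C = {..<\<nu>} \<union> diagonal_union (\<lambda>\<beta>. {..<h \<beta>})"
    by (auto simp: C_def diagonal_union_def not_le)
  then have "- C \<in> J"
    using null_Un lessThan_null diagonal_null by simp
  moreover have "B s \<subseteq> {..<\<alpha>}" if "\<alpha> \<in> C" "finite s" "s \<subseteq> {..<\<alpha>}" for \<alpha> s
  proof -
    have "\<exists>\<beta><\<alpha>. s \<subseteq> {..\<beta>}"
    proof (cases "s = {}")
      case True
      have "{..<\<nu>} \<noteq> {}" using infinite_index by auto
      then obtain \<beta> where "\<beta> < \<nu>" by auto
      then have "\<beta> < \<alpha>" using that(1) by (auto simp: C_def intro: less_le_trans)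
      with True show ?thesis by blast
    next
      case False
      then have "Max s < \<alpha>" using that Max_in by blast
      then show ?thesis using that(2) by (intro exI[of _ "Max s"]) auto
    qed
    then obtain \<beta> where \<beta>: "\<beta> < \<alpha>" "s \<subseteq> {..\<beta>}" by blast
    then have "b s < h \<beta>" using h[of \<beta>] that(2) by (auto simp: Fpow_def)
    also have "h \<beta> \<le> \<alpha>" using that(1) \<beta>(1) by (simp add: C_def)
    finally show ?thesis using b[OF that(2)] by auto
  qed
  ultimately show thesis using that[of C] by blast
qed

subsection \<open>The weak \<open>\<Delta>\<close>-system lemma\<close>

text \<open>Smallness alone gives no common bound when \<open>|\<nu>|\<close> is a limit cardinal.
  There are only \<open>|\<nu>|\<close> many bounds \<open>?U i\<close>, so one of them works on a
  positive subset.\<close>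

lemma uniform_size:
  assumes "pos n X" "\<And>a. small (F a)"
  obtains X' and K :: "'k set" where "X' \<subseteq> X" "pos n X'" "small K" "\<And>a. a \<in> X' \<Longrightarrow> |F a| \<le>o |K|"
proof -
  let ?U = "underS |{..<\<nu>}|"
  define Z where "Z i = {a\<in>X. |F a| \<le>o |?U i| }" for i
  have "X = (\<Union>i\<in>{..<\<nu>}. Z i)"
    using ordLess_imp_ordLeq_underS[OF card_of_Card_order assms(2)] by (auto simp: Field_card_of Z_def)
  then have "pos n (\<Union>i\<in>{..<\<nu>}. Z i)" using assms(1) by simp
  then obtain i where i: "i \<in> {..<\<nu>}" "pos n (Z i)"
    using pos_UN[OF card_lessThan] by blast
  show thesis
  proof (rule that)
    show "small (?U i)"
      using i(1) by (intro card_of_underS card_of_Card_order) (simp add: Field_card_of)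
  qed (use i in \<open>auto simp: Z_def\<close>)
qed

text \<open>There are at most \<open>|\<alpha>|\<close> many \<open>r\<close> below an infinite
  \<alpha>, and each value has size at most \<open>|\<alpha>|\<close>. One injection serves all
  \<open>r\<close> for a given \<alpha>, so a common element of two values gets the same code in
  both.\<close>

lemma collapse:
  assumes "\<And>a. small (F a)"
  obtains e :: "'k \<Rightarrow> 'b \<Rightarrow> 'k" where
    "\<And>\<alpha>. \<nu> \<le> \<alpha> \<Longrightarrow> inj_on (e \<alpha>) (\<Union>r\<in>[{..<\<alpha>}]\<^bsup>n\<^esup>. F (insert \<alpha> r))"
    "\<And>\<alpha>. \<nu> \<le> \<alpha> \<Longrightarrow> e \<alpha> ` (\<Union>r\<in>[{..<\<alpha>}]\<^bsup>n\<^esup>. F (insert \<alpha> r)) \<subseteq> {..<\<alpha>}"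
proof -
  have "\<exists>e. inj_on e (\<Union>r\<in>[{..<\<alpha>}]\<^bsup>n\<^esup>. F (insert \<alpha> r)) \<and>
      e ` (\<Union>r\<in>[{..<\<alpha>}]\<^bsup>n\<^esup>. F (insert \<alpha> r)) \<subseteq> {..<\<alpha>}" if "\<nu> \<le> \<alpha>" for \<alpha>
  proof -
    have sub: "{..<\<nu>} \<subseteq> {..<\<alpha>}" using that by auto
    then have inf: "infinite {..<\<alpha>}" using infinite_index finite_subset by blast
    have "|F a| \<le>o |{..<\<alpha>}|" for a
      using assms card_of_mono1[OF sub] ordLess_ordLeq_trans ordLess_imp_ordLeq by blast
    then have "|\<Union>r\<in>[{..<\<alpha>}]\<^bsup>n\<^esup>. F (insert \<alpha> r)| \<le>o |{..<\<alpha>}|"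
      by (intro card_of_UNION_ordLeq_infinite inf card_of_nsets_ordLeq) blast
    then show ?thesis unfolding card_of_ordLeq .
  qed
  then show thesis using that by metis
qed

text \<open>For each \<open>r\<close> with positively many extensions,
  \<open>regressive_cover\<close> is applied to the union of the part of
  \<open>F (insert \<alpha> r)\<close> below \<alpha> and its image under
  \<open>e \<alpha>\<close>.\<close>

lemma cover_extensions:
  assumes X: "pos (Suc n) X" and F: "\<And>a. small (F a)"
    and e: "\<forall>\<alpha>\<ge>\<nu>. e \<alpha> ` (\<Union>r\<in>[{..<\<alpha>}]\<^bsup>n\<^esup>. F (insert \<alpha> r)) \<subseteq> {..<\<alpha>}"
  shows "\<exists>R T G. R \<subseteq> [UNIV]\<^bsup>n\<^esup> \<and> pos n R \<and> (\<forall>r. small (G r)) \<and> (\<forall>r\<in>R. T r \<notin> J) \<and>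
    (\<forall>r\<in>R. \<forall>\<alpha>\<in>T r. \<nu> \<le> \<alpha> \<and> (\<forall>\<rho>\<in>r. \<rho> < \<alpha>) \<and> insert \<alpha> r \<in> X \<and>
      F (insert \<alpha> r) \<inter> {..<\<alpha>} \<subseteq> G r \<and> e \<alpha> ` F (insert \<alpha> r) \<subseteq> G r)"
proof -
  obtain X' and K :: "'k set" where X': "X' \<subseteq> X" "pos (Suc n) X'" and K: "small K"
    and FK: "\<And>a. a \<in> X' \<Longrightarrow> |F a| \<le>o |K|"
    by (rule uniform_size[where F = F, OF X F]) metis
  define S where "S r = {\<alpha>. \<nu> \<le> \<alpha> \<and> (\<forall>\<rho>\<in>r. \<rho> < \<alpha>) \<and> insert \<alpha> r \<in> X'}" for r
  define H where "H r \<alpha> = F (insert \<alpha> r) \<inter> {..<\<alpha>} \<union> e \<alpha> ` F (insert \<alpha> r)" for r \<alpha>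
  define R where "R = stem n X'"
  have KK: "small (K <+> K)"
    using infinite_index K K by (rule card_of_Plus_ordLess_infinite)
  have "\<exists>T G. T \<subseteq> S r \<and> T \<notin> J \<and> small G \<and> (\<forall>\<alpha>\<in>T. H r \<alpha> \<subseteq> G)" if r: "r \<in> R" for r
  proof -
    have "{\<alpha>. (\<forall>\<rho>\<in>r. \<rho> < \<alpha>) \<and> insert \<alpha> r \<in> X'} - {..<\<nu>} \<notin> J"
      using r lessThan_null by (intro positive_Diff) (auto simp: R_def stem_def)
    moreover have "{\<alpha>. (\<forall>\<rho>\<in>r. \<rho> < \<alpha>) \<and> insert \<alpha> r \<in> X'} - {..<\<nu>} = S r"
      by (auto simp: S_def)
    ultimately have S: "S r \<notin> J" by simp
    have reg: "H r \<alpha> \<subseteq> {..<\<alpha>}" if "\<alpha> \<in> S r" for \<alpha>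
    proof -
      have "r \<in> [{..<\<alpha>}]\<^bsup>n\<^esup>" using r that by (auto simp: R_def stem_def S_def nsets_def)
      then show ?thesis using e that by (auto simp: H_def S_def)
    qed
    have size: "|H r \<alpha>| \<le>o |K <+> K|" if "\<alpha> \<in> S r" for \<alpha>
    proof -
      have FK': "|F (insert \<alpha> r)| \<le>o |K|" using FK that by (simp add: S_def)
      have "|F (insert \<alpha> r) \<inter> {..<\<alpha>}| \<le>o |K|" "|e \<alpha> ` F (insert \<alpha> r)| \<le>o |K|"
        using ordLeq_transitive[OF card_of_mono1[OF Int_lower1] FK']
          ordLeq_transitive[OF card_of_image FK'] by auto
      then have "|(F (insert \<alpha> r) \<inter> {..<\<alpha>}) <+> (e \<alpha> ` F (insert \<alpha> r))| \<le>o |K <+> K|"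
        by (rule card_of_Plus_mono)
      with card_of_Un_Plus_ordLeq show ?thesis
        unfolding H_def by (rule ordLeq_transitive)
    qed
    show ?thesis
      using regressive_cover[OF S KK reg size] by metis
  qed
  then obtain T G where TG: "\<And>r. r \<in> R \<Longrightarrow> T r \<subseteq> S r \<and> T r \<notin> J \<and> small (G r) \<and> (\<forall>\<alpha>\<in>T r. H r \<alpha> \<subseteq> G r)"
    by metis
  have empty_small: "small ({} :: 'k set)"
    using infinite_index by (simp add: finite_ordLess_card_of)
  show ?thesis
  proof (intro exI conjI allI ballI)
    show "R \<subseteq> [UNIV]\<^bsup>n\<^esup>" by (auto simp: R_def stem_def)
    show "pos n R" using X'(2) by (simp add: R_def)
    \<comment> \<open>Outside \<open>R\<close> the cover is set to be empty, because the induction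
      will require small values everywhere.\<close>
    show "small (if r \<in> R then G r else {})" for r
      using TG empty_small by simp
    fix r assume r: "r \<in> R"
    show "T r \<notin> J" using TG r by simp
    fix \<alpha> assume \<alpha>: "\<alpha> \<in> T r"
    show "\<nu> \<le> \<alpha>" using TG[OF r] \<alpha> by (auto simp: S_def)
    show "\<rho> < \<alpha>" if "\<rho> \<in> r" for \<rho> using TG[OF r] \<alpha> that by (auto simp: S_def)
    show "insert \<alpha> r \<in> X"
      using TG[OF r] \<alpha> X'(1) by (auto simp: S_def)
    show "F (insert \<alpha> r) \<inter> {..<\<alpha>} \<subseteq> (if r \<in> R then G r else {})"
      "e \<alpha> ` F (insert \<alpha> r) \<subseteq> (if r \<in> R then G r else {})"
      using TG[OF r] r \<alpha> unfolding H_def by simp_all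
  qed
qed

text \<open>The function \<open>B\<close> strengthens the statement for the induction: every element \<open>x\<close> of \<open>F a\<close> is
  captured by the initial segment of \<open>a\<close> up to \<open>x\<close>. It serves to
  compare sets with different maxima.\<close>

lemma weak_Delta_system:
  fixes F :: "'k set \<Rightarrow> 'k set"
  assumes "X \<subseteq> [UNIV]\<^bsup>n\<^esup>" "pos n X" "\<And>a. small (F a)"
  shows "\<exists>Y W B. Y \<subseteq> X \<and> pos n Y \<and> (\<forall>c. finite c \<longrightarrow> small (W c :: 'k set)) \<and>
    (\<forall>s. finite s \<longrightarrow> small (B s :: 'k set)) \<and>
    (\<forall>a\<in>Y. \<forall>b\<in>Y. a \<noteq> b \<longrightarrow> aligned a b \<longrightarrow> F a \<inter> F b \<subseteq> W (a \<inter> b)) \<and>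
    (\<forall>a\<in>Y. \<forall>x\<in>F a. x \<in> B (a \<inter> {..x}))"
  using assms
proof (induction n arbitrary: X F)
  case 0
  then have "X = {{}}" by (auto simp: nsets_def)
  moreover have "small ({} :: 'k set)"
    using infinite_index by (simp add: finite_ordLess_card_of)
  ultimately show ?case
    using "0.prems" by (intro exI[of _ X] exI[of _ "\<lambda>_. {}"] exI[of _ F]) auto
next
  case (Suc n)
  define U where "U \<alpha> = (\<Union>r\<in>[{..<\<alpha>}]\<^bsup>n\<^esup>. F (insert \<alpha> r))" for \<alpha>
  obtain e :: "'k \<Rightarrow> 'k \<Rightarrow> 'k" where e_inj: "\<And>\<alpha>. \<nu> \<le> \<alpha> \<Longrightarrow> inj_on (e \<alpha>) (U \<alpha>)"
    and e_less: "\<forall>\<alpha>\<ge>\<nu>. e \<alpha> ` U \<alpha> \<subseteq> {..<\<alpha>}"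
    unfolding U_def by (rule collapse[where F = F and n = n, OF Suc.prems(3)]) metis
  obtain R T G where R: "R \<subseteq> [UNIV]\<^bsup>n\<^esup>" "pos n R" and "\<forall>r. small (G r)"
    and "\<forall>r\<in>R. T r \<notin> J"
    and ext: "\<forall>r\<in>R. \<forall>\<alpha>\<in>T r. \<nu> \<le> \<alpha> \<and> (\<forall>\<rho>\<in>r. \<rho> < \<alpha>) \<and> insert \<alpha> r \<in> X \<and>
      F (insert \<alpha> r) \<inter> {..<\<alpha>} \<subseteq> G r \<and> e \<alpha> ` F (insert \<alpha> r) \<subseteq> G r"
    using cover_extensions[where F = F, OF Suc.prems(2,3) e_less[unfolded U_def]]
    by (elim exE conjE) (rule that)
  then have G: "\<And>r. small (G r)" and T: "\<And>r. r \<in> R \<Longrightarrow> T r \<notin> J" by simp_all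
  obtain Y\<^sub>0 W\<^sub>0 B\<^sub>0 where Y\<^sub>0: "Y\<^sub>0 \<subseteq> R" "pos n Y\<^sub>0"
    and W\<^sub>0: "\<forall>c. finite c \<longrightarrow> small (W\<^sub>0 c :: 'k set)"
    and B\<^sub>0: "\<forall>s. finite s \<longrightarrow> small (B\<^sub>0 s :: 'k set)"
    and W\<^sub>0G: "\<forall>r\<in>Y\<^sub>0. \<forall>q\<in>Y\<^sub>0. r \<noteq> q \<longrightarrow> aligned r q \<longrightarrow> G r \<inter> G q \<subseteq> W\<^sub>0 (r \<inter> q)"
    and B\<^sub>0G: "\<forall>r\<in>Y\<^sub>0. \<forall>x\<in>G r. x \<in> B\<^sub>0 (r \<inter> {..x})"
    using Suc.IH[of R G, OF R G] by (elim exE conjE) (rule that)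
  have fin: "finite r" "card r = n" if "r \<in> Y\<^sub>0" for r
    using that Y\<^sub>0(1) R(1) by (auto simp: nsets_def)
  \<comment> \<open>On full tuples \<open>B\<close> is \<open>F\<close>, so closure points above a
    tuple bound its value; shorter initial segments keep the capturing property of
    \<open>B\<^sub>0\<close>.\<close>
  define B where "B s = (if s \<in> [UNIV]\<^bsup>Suc n\<^esup> then F s else B\<^sub>0 s)" for s
  have B: "small (B s)" if "finite s" for s
    using that B\<^sub>0 Suc.prems(3) by (simp add: B_def)
  obtain C where C: "- C \<in> J"
    and BC: "\<forall>\<alpha>\<in>C. \<forall>s. finite s \<longrightarrow> s \<subseteq> {..<\<alpha>} \<longrightarrow> B s \<subseteq> {..<\<alpha>}"
    by (rule closure_points[of B, OF B])
  define node where "node r \<alpha> \<longleftrightarrow> r \<in> Y\<^sub>0 \<and> r \<subseteq> C \<and> \<alpha> \<in> T r \<and> \<alpha> \<in> C" for r \<alpha>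
  define Y where "Y = {insert \<alpha> r | r \<alpha>. node r \<alpha>}"
  have node: "finite r" "card r = n" "\<nu> \<le> \<alpha>" "\<forall>\<rho>\<in>r. \<rho> < \<alpha>" "\<alpha> \<notin> r" "insert \<alpha> r \<in> X"
    "F (insert \<alpha> r) \<inter> {..<\<alpha>} \<subseteq> G r" "e \<alpha> ` F (insert \<alpha> r) \<subseteq> G r"
    "B (insert \<alpha> r) = F (insert \<alpha> r)" "F (insert \<alpha> r) \<subseteq> U \<alpha>"
    if "node r \<alpha>" for r \<alpha>
  proof -
    have r: "r \<in> Y\<^sub>0" "r \<in> R" "\<alpha> \<in> T r" using that Y\<^sub>0(1) by (auto simp: node_def)
    show "finite r" "card r = n" using fin r(1) by auto
    show *: "\<nu> \<le> \<alpha>" "\<forall>\<rho>\<in>r. \<rho> < \<alpha>" "insert \<alpha> r \<in> X" using ext r(2,3) by blast+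
    then show "\<alpha> \<notin> r" by blast
    show "F (insert \<alpha> r) \<inter> {..<\<alpha>} \<subseteq> G r" "e \<alpha> ` F (insert \<alpha> r) \<subseteq> G r" using ext r(2,3) by blast+
    show "B (insert \<alpha> r) = F (insert \<alpha> r)"
      using * Suc.prems(1) by (auto simp: B_def)
    have "r \<in> [{..<\<alpha>}]\<^bsup>n\<^esup>" using * \<open>finite r\<close> \<open>card r = n\<close> by (auto simp: nsets_def)
    then show "F (insert \<alpha> r) \<subseteq> U \<alpha>" by (auto simp: U_def)
  qed
  have "{r\<in>Y\<^sub>0. r \<subseteq> C} \<subseteq> stem n Y"
  proof
    fix r assume r: "r \<in> {r\<in>Y\<^sub>0. r \<subseteq> C}"
    then have "r \<in> R" using Y\<^sub>0(1) by blast
    have "T r - - C \<notin> J" using T[OF \<open>r \<in> R\<close>] C by (rule positive_Diff)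
    moreover have "T r - - C \<subseteq> {\<alpha>. (\<forall>\<rho>\<in>r. \<rho> < \<alpha>) \<and> insert \<alpha> r \<in> Y}"
      using r ext \<open>r \<in> R\<close> by (auto simp: Y_def node_def)
    ultimately have "{\<alpha>. (\<forall>\<rho>\<in>r. \<rho> < \<alpha>) \<and> insert \<alpha> r \<in> Y} \<notin> J"
      using null_mono by blast
    then show "r \<in> stem n Y" using \<open>r \<in> R\<close> R(1) by (auto simp: stem_def)
  qed
  then have "pos (Suc n) Y" using pos_restrict[OF C Y\<^sub>0(2)] pos_mono by simp
  \<comment> \<open>The preimage under \<open>e m\<close> pulls a bound on codes back to a bound on
    elements.\<close>
  define V where "V m Z = {x \<in> U m. e m x \<in> Z}" for m Z
  have V: "small (V m Z)" if "\<nu> \<le> m" "small Z" for m Z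
  proof -
    have "inj_on (e m) (V m Z)"
      using e_inj[OF that(1)] by (rule inj_on_subset) (auto simp: V_def)
    then have "|V m Z| \<le>o |Z|"
      using card_of_ordLeq[of "V m Z" Z] by (auto simp: V_def)
    then show ?thesis using that(2) by (rule ordLeq_ordLess_trans)
  qed
  \<comment> \<open>For different maxima, \<open>G c\<close> serves \<open>r = q = c\<close> and
    \<open>W\<^sub>0 c\<close> serves \<open>r \<noteq> q\<close>. The last part serves a common
    maximum, which is then \<open>Max c\<close>; its guard ensures that \<open>e (Max c)\<close> is
    injective, and covers the unspecified \<open>Max {}\<close>.\<close>
  define W where "W c = G c \<union> W\<^sub>0 c \<union> (if \<nu> \<le> Max c then V (Max c) (W\<^sub>0 (c - {Max c})) else {})" for c
  have W: "small (W c)" if "finite c" for c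
  proof -
    have "small ({} :: 'k set)"
      using infinite_index by (simp add: finite_ordLess_card_of)
    then have "small (if \<nu> \<le> Max c then V (Max c) (W\<^sub>0 (c - {Max c})) else {})"
      using V W\<^sub>0 that by simp
    then show ?thesis
      unfolding W_def using G W\<^sub>0[rule_format, OF that] infinite_index by (intro card_of_Un_ordLess_infinite)
  qed
  have cross: "F (insert \<alpha> r) \<inter> F (insert \<beta> q) \<subseteq> W (insert \<alpha> r \<inter> insert \<beta> q)"
    if nodes: "node r \<alpha>" "node q \<beta>" and "\<alpha> < \<beta>" "\<alpha> \<notin> q" and rq: "r \<noteq> q \<Longrightarrow> G r \<inter> G q \<subseteq> W\<^sub>0 (r \<inter> q)"
    for r q \<alpha> \<beta>
  proof
    fix x assume x: "x \<in> F (insert \<alpha> r) \<inter> F (insert \<beta> q)"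
    note r = node[OF nodes(1)] and q = node[OF nodes(2)]
    have bound: "x < m" if "m \<in> C" "\<alpha> < m" for m
    proof -
      have "insert \<alpha> r \<subseteq> {..<m}" using r(4) that(2) by auto
      then have "F (insert \<alpha> r) \<subseteq> {..<m}"
        using BC[rule_format, of m "insert \<alpha> r"] that(1) r(1,9) by simp
      then show ?thesis using x by auto
    qed
    have "\<beta> \<notin> r" using r(4) \<open>\<alpha> < \<beta>\<close> by auto
    then have int: "insert \<alpha> r \<inter> insert \<beta> q = r \<inter> q" using that(3,4) by auto
    have "x < \<beta>" using bound nodes(2) \<open>\<alpha> < \<beta>\<close> by (simp add: node_def)
    then have xq: "x \<in> G q" using q(7) x by auto
    have "x < \<alpha>"
    proof (rule ccontr)
      assume "\<not> x < \<alpha>"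
      \<comment> \<open>As \<open>x\<close> lies in \<open>G q\<close>, it is captured by
        \<open>B ?t\<close>. If \<open>?t\<close> were below the closure point \<alpha>, so would be
        \<open>x\<close>; hence some \<open>m\<close> in \<open>q\<close> satisfies
        \<open>\<alpha> < m \<le> x\<close>. But \<open>m\<close> is itself a closure point, so it
        bounds \<open>F (insert \<alpha> r)\<close> and exceeds \<open>x\<close>.\<close>
      let ?t = "q \<inter> {..x}"
      have "card ?t \<le> n" using card_mono[OF q(1) Int_lower1] q(2) by auto
      then have Bt: "B ?t = B\<^sub>0 ?t" by (auto simp: B_def nsets_def)
      have "x \<in> B ?t" unfolding Bt using nodes(2) xq by (intro B\<^sub>0G[rule_format]) (auto simp: node_def)
      then have "\<not> ?t \<subseteq> {..<\<alpha>}"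
        using BC[rule_format, of \<alpha> ?t] nodes(1) q(1) \<open>\<not> x < \<alpha>\<close> by (auto simp: node_def)
      then obtain m where "m \<in> ?t" "m \<notin> {..<\<alpha>}" by blast
      then have "m \<in> q" "m \<le> x" "\<alpha> \<le> m" by auto
      moreover from this have "\<alpha> < m" using \<open>\<alpha> \<notin> q\<close> by (cases "m = \<alpha>") auto
      ultimately show False using bound[of m] nodes(2) by (auto simp: node_def)
    qed
    then have xr: "x \<in> G r" using r(7) x by auto
    show "x \<in> W (insert \<alpha> r \<inter> insert \<beta> q)"
      unfolding int using rq xr xq by (cases "r = q") (auto simp: W_def)
  qed
  have "F a \<inter> F b \<subseteq> W (a \<inter> b)" if ab: "a \<in> Y" "b \<in> Y" "a \<noteq> b" "aligned a b" for a b
  proof -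
    obtain r \<alpha> q \<beta> where a: "a = insert \<alpha> r" "node r \<alpha>" and b: "b = insert \<beta> q" "node q \<beta>"
      using ab(1,2) by (auto simp: Y_def)
    note r = node[OF a(2)] and q = node[OF b(2)]
    have al: "aligned r q" "\<alpha> \<in> insert \<beta> q \<Longrightarrow> \<alpha> = \<beta>" "\<beta> \<in> insert \<alpha> r \<Longrightarrow> \<alpha> = \<beta>"
      using aligned_insert[OF r(4) q(4)] ab(4) a(1) b(1) by auto
    have rq: "G r \<inter> G q \<subseteq> W\<^sub>0 (r \<inter> q)" if "r \<noteq> q"
      using W\<^sub>0G that al(1) a(2) b(2) by (auto simp: node_def)
    consider "\<alpha> < \<beta>" | "\<beta> < \<alpha>" | "\<alpha> = \<beta>" by (rule linorder_cases)
    then show ?thesis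
    proof cases
      case 1
      then show ?thesis unfolding a(1) b(1) using a(2) b(2) al(2) rq by (intro cross) auto
    next
      case 2
      then have "F b \<inter> F a \<subseteq> W (b \<inter> a)"
        unfolding a(1) b(1) using a(2) b(2) al(3) rq by (intro cross) (auto simp: Int_commute)
      then show ?thesis by (simp add: Int_commute)
    next
      case 3
      have "r \<noteq> q" using 3 a(1) b(1) ab(3) by auto
      have int: "a \<inter> b = insert \<alpha> (r \<inter> q)" using 3 a(1) b(1) by auto
      have Max: "Max (a \<inter> b) = \<alpha>"
        unfolding int using r(1,4) by (intro Max_eqI) (auto intro: less_imp_le)
      have diff: "a \<inter> b - {\<alpha>} = r \<inter> q" unfolding int using r(5) by auto
      show ?thesis
      proof
        fix x assume x: "x \<in> F a \<inter> F b"
        \<comment> \<open>Here \<open>x\<close> need not lie below \<alpha>, so its code is compared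
          instead of \<open>x\<close> itself.\<close>
        then have "e \<alpha> x \<in> G r \<inter> G q" using r(8) q(8) 3 a(1) b(1) by auto
        then have "x \<in> V \<alpha> (W\<^sub>0 (r \<inter> q))"
          using rq[OF \<open>r \<noteq> q\<close>] r(10) x a(1) by (auto simp: V_def)
        then show "x \<in> W (a \<inter> b)"
          unfolding W_def Max diff using r(3) by simp
      qed
    qed
  qed
  moreover have "x \<in> B (a \<inter> {..x})" if a: "a \<in> Y" and x: "x \<in> F a" for a x
  proof -
    obtain r \<alpha> where a: "a = insert \<alpha> r" "node r \<alpha>" using a by (auto simp: Y_def)
    note r = node[OF a(2)]
    show ?thesis
    proof (cases "x < \<alpha>")
      case False
      then have "a \<inter> {..x} = a" using r(4) a(1) by (auto simp: not_less)
      then show ?thesis using r(9) x a(1) by simp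
    next
      case True
      then have int: "a \<inter> {..x} = r \<inter> {..x}" using a(1) by auto
      have "card (r \<inter> {..x}) \<le> n" using card_mono[OF r(1) Int_lower1] r(2) by auto
      then have "B (r \<inter> {..x}) = B\<^sub>0 (r \<inter> {..x})" by (auto simp: B_def nsets_def)
      moreover have "x \<in> G r" using r(7) x True a(1) by auto
      ultimately show ?thesis unfolding int using B\<^sub>0G a(2) by (auto simp: node_def)
    qed
  qed
  moreover have "Y \<subseteq> X" using node(6) by (auto simp: Y_def)
  ultimately show ?case
    using \<open>pos (Suc n) Y\<close> W B by blast
qed

lemma weak_Delta_system_lemma: "weak_Delta_system_lemma |{..<\<nu>}| J n"
  unfolding weak_Delta_system_lemma_def
proof (intro ballI)
  fix X and F :: "'k set \<Rightarrow> 'k set"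
  assume X: "X \<in> fubini_positive J (n + 1)" and F: "F \<in> X \<rightarrow> subsets_less |{..<\<nu>}|"
  \<comment> \<open>The family is controlled only on \<open>X\<close>; the induction needs small
    values at every set.\<close>
  define F' where "F' a = (if a \<in> X then F a else {})" for a
  have "small (F' a)" for a
    using F infinite_index by (auto simp: F'_def subsets_less_def finite_ordLess_card_of)
  moreover have "X \<subseteq> [UNIV]\<^bsup>(n + 1)\<^esup>" "pos (n + 1) X"
    using X by (simp_all only: fubini_positive_iff)
  ultimately obtain Y W where Y: "Y \<subseteq> X" "pos (n + 1) Y"
    and W: "\<And>c. finite c \<Longrightarrow> small (W c :: 'k set)"
    and FW: "\<And>a b. \<lbrakk>a \<in> Y; b \<in> Y; a \<noteq> b; aligned a b\<rbrakk> \<Longrightarrow> F' a \<inter> F' b \<subseteq> W (a \<inter> b)"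
    using weak_Delta_system[of X "n + 1" F'] by metis
  show "\<exists>W\<in>subsets_at_most n \<rightarrow> subsets_less |{..<\<nu>}|. \<exists>Y\<in>fubini_positive J (n + 1). Y \<subseteq> X \<and>
      (\<forall>a\<in>Y. \<forall>b\<in>Y. a \<noteq> b \<longrightarrow> aligned a b \<longrightarrow> F a \<inter> F b \<subseteq> W (a \<inter> b))"
  proof (intro bexI conjI ballI impI)
    show "W \<in> subsets_at_most n \<rightarrow> subsets_less |{..<\<nu>}|"
      using W by (auto simp: subsets_at_most_def subsets_less_def)
    show "Y \<in> fubini_positive J (n + 1)"
      using Y \<open>X \<subseteq> [UNIV]\<^bsup>(n + 1)\<^esup>\<close> unfolding fubini_positive_iff by blast
    show "Y \<subseteq> X" by (rule Y(1))
    fix a b assume "a \<in> Y" "b \<in> Y" "a \<noteq> b" "aligned a b"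
    moreover from this have "F' a = F a" "F' b = F b"
      using Y(1) by (auto simp: F'_def)
    ultimately show "F a \<inter> F b \<subseteq> W (a \<inter> b)"
      using FW[of a b] by simp
  qed
qed

end

theorem theorem1p8:
  fixes J :: "'k::wellorder set set" and \<gamma> :: 'k
  assumes "is_cardinal TYPE('k)"
    and "is_ideal J" and "proper_ideal J" and "uniform_ideal J" and "normal_ideal J"
    and "saturated_ideal \<gamma> J"
  shows "\<forall>\<nu>\<ge>\<gamma>. infinite {..<\<nu>} \<longrightarrow> (\<forall>n::nat. weak_Delta_system_lemma |{..<\<nu>}| J n)"
proof (intro allI impI)
  fix \<nu> n assume "\<gamma> \<le> \<nu>" "infinite {..<\<nu>}"
  \<comment> \<open>Saturation passes from \<gamma> to the larger \<nu> by restricting sequences to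
    their first \<gamma> terms.\<close>
  have "saturated_ideal \<nu> J"
    unfolding saturated_ideal_def
  proof (intro allI impI)
    fix X :: "'k \<Rightarrow> 'k set" assume "\<forall>i<\<nu>. X i \<in> positive J"
    then have "\<forall>i<\<gamma>. X i \<in> positive J" using \<open>\<gamma> \<le> \<nu>\<close> by auto
    then obtain i j where "i < j" "j < \<gamma>" "X i \<inter> X j \<in> positive J"
      using assms(6) unfolding saturated_ideal_def by blast
    then show "\<exists>i j. i < j \<and> j < \<nu> \<and> X i \<inter> X j \<in> positive J"
      using \<open>\<gamma> \<le> \<nu>\<close> less_le_trans by blast
  qed
  then interpret saturated_normal_ideal J \<nu>
    using assms \<open>infinite {..<\<nu>}\<close> by unfold_locales
  show "weak_Delta_system_lemma |{..<\<nu>}| J n" by (rule weak_Delta_system_lemma)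
qed

end
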